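(* Let $H$ be a connected graph with $n(H)\ge 2$. Then (i) $\underline{{\rm gp}}_{\rm S}(K_2,H)=2\xi^{-}(H)$, and (ii) ${\rm gp}_{\rm S}(K_2,H)=2\xi(H)$.
   Context: All graphs are finite, simple and connected; $n(H)=|V(H)|$. For vertices $x,y$, $I_H[x,y]=\{w: d_H(x,y)=d_H(x,w)+d_H(w,y)\}$ with $d_H$ the distance. A set $X$ of vertices is a general position set if no shortest path contains more than two vertices of $X$; ${\rm gp}$ denotes the maximum cardinality of a general position set. For $u\in V(H)$, a set $S\subseteq V(H)$ is $u$-colinear if $S$ is a general position set of $H$, $u\notin S$, and $y\notin I_H[x,u]$ for all distinct $x,y\in S$; $\xi_H(u)$ is the maximum cardinality of a $u$-colinear set, $\xi^{-}(H)=\min_{u}\xi_H(u)$ and $\xi(H)=\max_u\xi_H(u)$. For $f\colon V(G)\to V(H)$, the Sierpiński product $G\otimes_f H$ has vertex set $V(G)\times V(H)$ and edges $(g,h)(g,h')$ for $g\in V(G)$, $hh'\in E(H)$, and $(g,f(g'))(g',f(g))$ for $gg'\in E(G)$. ${\rm gp}_{\rm S}(G,H)=\max_f{\rm gp}(G\otimes_f H)$ and $\underline{{\rm gp}}_{\rm S}(G,H)=\min_f{\rm gp}(G\otimes_f H)$, over all functions $f\colon V(G)\to V(H)$. *)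

theory Defs
  imports "Graph_Theory.Graph_Theory" "HOL-Library.FuncSet"
begin

text \<open>
  A finite simple graph is a \<open>pair_graph\<close>: each edge \<open>xy\<close> is represented by the two
  arcs \<open>(x, y)\<close> and \<open>(y, x)\<close>.
\<close>

text \<open>
  The value is meaningful only if \<open>y\<close> is reachable from \<open>x\<close>; see \<open>gdist_eq_\<mu>\<close> below
  for the agreement with the weighted distance \<open>\<mu>\<close> under unit weights.
\<close>

definition gdist :: "'a pair_pre_digraph \<Rightarrow> 'a \<Rightarrow> 'a \<Rightarrow> nat" where
  "gdist H x y = (LEAST n. \<exists>p. pre_digraph.awalk (with_proj H) x p y \<and> length p = n)"

definition ginterval :: "'a pair_pre_digraph \<Rightarrow> 'a \<Rightarrow> 'a \<Rightarrow> 'a set" where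
  "ginterval H x y = {w \<in> pverts H. gdist H x y = gdist H x w + gdist H w y}"

definition shortest_path :: "'a pair_pre_digraph \<Rightarrow> 'a \<Rightarrow> ('a \<times> 'a) awalk \<Rightarrow> 'a \<Rightarrow> bool" where
  "shortest_path H x p y \<longleftrightarrow> pre_digraph.apath (with_proj H) x p y \<and> length p = gdist H x y"

definition general_position :: "'a pair_pre_digraph \<Rightarrow> 'a set \<Rightarrow> bool" where
  "general_position H X \<longleftrightarrow> X \<subseteq> pverts H \<and>
    (\<forall>x p y. shortest_path H x p y \<longrightarrow>
      card (X \<inter> set (pre_digraph.awalk_verts (with_proj H) x p)) \<le> 2)"

definition gp :: "'a pair_pre_digraph \<Rightarrow> nat" where
  "gp H = Max {card X | X. general_position H X}"

definition colinear :: "'a pair_pre_digraph \<Rightarrow> 'a \<Rightarrow> 'a set \<Rightarrow> bool" where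
  "colinear H u S \<longleftrightarrow> general_position H S \<and> u \<notin> S \<and>
    (\<forall>x\<in>S. \<forall>y\<in>S. x \<noteq> y \<longrightarrow> y \<notin> ginterval H x u)"

definition \<xi>_at :: "'a pair_pre_digraph \<Rightarrow> 'a \<Rightarrow> nat" where
  "\<xi>_at H u = Max {card S | S. colinear H u S}"

definition \<xi>_min :: "'a pair_pre_digraph \<Rightarrow> nat" where
  "\<xi>_min H = Min (\<xi>_at H ` pverts H)"

definition \<xi>_max :: "'a pair_pre_digraph \<Rightarrow> nat" where
  "\<xi>_max H = Max (\<xi>_at H ` pverts H)"

definition sierpinski_product ::
  "'a pair_pre_digraph \<Rightarrow> ('a \<Rightarrow> 'b) \<Rightarrow> 'b pair_pre_digraph \<Rightarrow> ('a \<times> 'b) pair_pre_digraph" where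
  "sierpinski_product G f H = \<lparr>
     pverts = pverts G \<times> pverts H,
     parcs = {((g, h), (g, h')) | g h h'. g \<in> pverts G \<and> (h, h') \<in> parcs H}
           \<union> {((g, f g'), (g', f g)) | g g'. (g, g') \<in> parcs G} \<rparr>"

definition gp_S_max :: "'a pair_pre_digraph \<Rightarrow> 'b pair_pre_digraph \<Rightarrow> nat" where
  "gp_S_max G H = Max {gp (sierpinski_product G f H) | f. f \<in> pverts G \<rightarrow>\<^sub>E pverts H}"

definition gp_S_min :: "'a pair_pre_digraph \<Rightarrow> 'b pair_pre_digraph \<Rightarrow> nat" where
  "gp_S_min G H = Min {gp (sierpinski_product G f H) | f. f \<in> pverts G \<rightarrow>\<^sub>E pverts H}"

lemma gdist_eq_\<mu>:
  assumes "pair_wf_digraph H" and "x \<rightarrow>\<^sup>*\<^bsub>with_proj H\<^esub> y"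
  shows "ereal (real (gdist H x y)) = wf_digraph.\<mu> (with_proj H) (\<lambda>_. 1) x y"
proof -
  interpret pair_wf_digraph H by fact
  have cost: "awalk_cost (\<lambda>_. 1) p = real (length p)" for p :: "('a \<times> 'a) awalk"
    by (induct p) auto
  from assms(2) obtain q where "awalk x q y" by (auto simp: reachable_awalk)
  then have "\<exists>n p. awalk x p y \<and> length p = n" by blast
  then have "\<exists>p. awalk x p y \<and> length p = gdist H x y"
    unfolding gdist_def by (rule LeastI_ex)
  then obtain p where p: "awalk x p y" "length p = gdist H x y" by blast
  have le: "gdist H x y \<le> length q" if "awalk x q y" for q
    unfolding gdist_def using that by (blast intro: Least_le)
  show ?thesis
    unfolding \<mu>_def cost
  proof (rule INF_eqI[symmetric])
    show "ereal (real (gdist H x y)) \<le> ereal (real (length q))" if "q \<in> {p. awalk x p y}" for q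
      using that le by simp
    show "l \<le> ereal (real (gdist H x y))"
      if "\<And>q. q \<in> {p. awalk x p y} \<Longrightarrow> l \<le> ereal (real (length q))" for l
      using that[of p] p(1) unfolding p(2) by simp
  qed
qed

lemma pair_graph_sierpinski_product:
  assumes G: "pair_graph G" and H: "pair_graph H"
    and f: "f \<in> pverts G \<rightarrow> pverts H"
  shows "pair_graph (sierpinski_product G f H)" (is "pair_graph ?P")
proof -
  interpret G: pair_graph G by fact
  interpret H: pair_graph H by fact
  have sub: "parcs ?P \<subseteq> pverts ?P \<times> pverts ?P"
    using f by (auto simp: sierpinski_product_def dest: G.in_arcsD1 G.in_arcsD2
        H.in_arcsD1 H.in_arcsD2)
  have fin: "finite (pverts ?P)"
    by (simp add: sierpinski_product_def G.pair_finite_verts H.pair_finite_verts)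
  have symm: "symmetric (with_proj ?P)"
    unfolding symmetric_def with_proj_simps
  proof (rule symI)
    fix a b assume "(a, b) \<in> parcs ?P"
    then show "(b, a) \<in> parcs ?P"
      using G.arcs_symmetric H.arcs_symmetric unfolding sierpinski_product_def by auto
  qed
  have loopfree: "fst e \<noteq> snd e" if "e \<in> parcs ?P" for e
    using that G.pair_no_loops H.pair_no_loops unfolding sierpinski_product_def by force
  show ?thesis
  proof
    show "finite (parcs ?P)"
      by (rule finite_subset[OF sub finite_cartesian_product[OF fin fin]])
    show "fst e \<in> pverts ?P" "snd e \<in> pverts ?P" if "e \<in> parcs ?P" for e
      using subsetD[OF sub that] by (simp_all add: mem_Times_iff)
  qed (fact loopfree fin symm)+
qed

end

theory Submission
  imports Defs
begin

text \<open>
  The product of \<open>K\<^sub>2 = ab\<close> with \<open>H\<close> is two copies of \<open>H\<close> joined by a bridge from \<open>f b\<close> in the copy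
  of \<open>a\<close> to \<open>f a\<close> in the copy of \<open>b\<close>. If a general position set meets both copies, its parts are
  colinear with respect to the bridge ends (or are the bridge end itself), and conversely any two
  colinear sets can be combined. A general position set inside one copy is no larger, since it is
  a union of two \<open>u\<close>-colinear sets for every \<open>u\<close> outside it, and becomes \<open>u\<close>-colinear on removing
  \<open>u\<close> otherwise. Hence \<open>gp\<close> of the product is \<open>\<xi>_at H (f a) + \<xi>_at H (f b)\<close>, and \<open>f a\<close> and \<open>f b\<close>
  range independently over the vertices.
\<close>

section \<open>Distances in a connected graph\<close>

lemma (in pair_wf_digraph) gdist_le:
  assumes "awalk x p y"
  shows "gdist G x y \<le> length p"
  unfolding gdist_def using assms by (blast intro: Least_le)

text \<open>Connectivity in the form in which it is used: \<open>gdist\<close> is a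
  \<open>LEAST\<close>, whose value is attained once some walk exists.\<close>

locale connected_pair_graph = pair_graph +
  assumes ex_awalk: "\<lbrakk>x \<in> pverts G; y \<in> pverts G\<rbrakk> \<Longrightarrow> \<exists>p. awalk x p y"
begin

lemma shortest_awalkE:
  assumes "x \<in> pverts G" "y \<in> pverts G"
  obtains p where "awalk x p y" "length p = gdist G x y"
proof -
  have "\<exists>n p. awalk x p y \<and> length p = n" using ex_awalk[OF assms] by blast
  then have "\<exists>p. awalk x p y \<and> length p = gdist G x y"
    unfolding gdist_def by (rule LeastI_ex)
  then show thesis using that by blast
qed

lemma gdist_self [simp]: "x \<in> pverts G \<Longrightarrow> gdist G x x = 0"
  using gdist_le[of x "[]" x] by (simp add: awalk_Nil_iff)

lemma gdist_eq_0_iff: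
  assumes "x \<in> pverts G" "y \<in> pverts G"
  shows "gdist G x y = 0 \<longleftrightarrow> x = y"
proof
  assume "gdist G x y = 0"
  then show "x = y" by (auto intro: shortest_awalkE[OF assms] simp: awalk_Nil_iff)
qed (use assms in simp)

lemma gdist_triangle:
  assumes "x \<in> pverts G" "y \<in> pverts G" "z \<in> pverts G"
  shows "gdist G x z \<le> gdist G x y + gdist G y z"
proof -
  obtain p where p: "awalk x p y" "length p = gdist G x y"
    using assms by (auto elim: shortest_awalkE)
  obtain q where q: "awalk y q z" "length q = gdist G y z"
    using assms by (auto elim: shortest_awalkE)
  show ?thesis using gdist_le[OF awalk_appendI[OF p(1) q(1)]] p q by simp
qed

lemma gdist_commute:
  assumes "x \<in> pverts G" "y \<in> pverts G"
  shows "gdist G x y = gdist G y x"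
proof -
  have len: "length (rev_path p) = length p" for p :: "('a \<times> 'a) awalk" by (induct p) auto
  have "gdist G y x \<le> gdist G x y" if V: "x \<in> pverts G" "y \<in> pverts G" for x y
  proof -
    obtain p where "awalk x p y" "length p = gdist G x y"
      using V by (rule shortest_awalkE)
    then show ?thesis using gdist_le[of y "rev_path p" x] by (simp add: len)
  qed
  then show ?thesis using assms by (simp add: le_antisym)
qed

lemma gdist_arc_le:
  assumes "(x, y) \<in> parcs G"
  shows "gdist G x y \<le> 1"
  using gdist_le[OF arc_implies_awalk[OF assms]] by simp

lemma gdist_arc_Suc:
  assumes "(x, y) \<in> parcs G" "z \<in> pverts G"
  shows "gdist G x z \<le> Suc (gdist G y z)"
  using gdist_triangle[of x y z] gdist_arc_le[OF assms(1)] assms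
    in_arcsD1[OF assms(1)] in_arcsD2[OF assms(1)] by simp

text \<open>A potential that drops by at most one along every arc and ends at 0 bounds the length of
  every walk to \<open>y\<close>. This gives lower bounds on distances without taking walks
  apart.\<close>

lemma potential_le_gdist:
  fixes \<phi> :: "'a \<Rightarrow> nat"
  assumes "x \<in> pverts G" "y \<in> pverts G"
    and "\<phi> y = 0" and "\<And>u v. (u, v) \<in> parcs G \<Longrightarrow> \<phi> u \<le> Suc (\<phi> v)"
  shows "\<phi> x \<le> gdist G x y"
proof -
  have "\<phi> x \<le> length p" if "awalk x p y" for x p
    using that
  proof (induct p arbitrary: x)
    case Nil
    then show ?case using assms(3) by (simp add: awalk_Nil_iff)
  next
    case (Cons e p)
    then have "\<phi> (snd e) \<le> length p" "(x, snd e) \<in> parcs G" by (auto simp: awalk_Cons_iff)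
    then show ?case using assms(4)[of x "snd e"] by simp
  qed
  then show ?thesis using assms(1,2) by (metis shortest_awalkE)
qed

section \<open>General position in terms of distances\<close>

lemma shortest_path_mono_dist:
  assumes p: "awalk x p y" "length p = gdist G x y"
    and ab: "a \<in> set (pawalk_verts x p)" "b \<in> set (pawalk_verts x p)"
    and le: "gdist G x a \<le> gdist G x b"
  shows "gdist G x b = gdist G x a + gdist G a b"
proof -
  have V: "x \<in> pverts G" "y \<in> pverts G" "a \<in> pverts G" "b \<in> pverts G"
    using p ab by auto
  obtain q r where qr: "p = q @ r" "awalk x q b" "awalk b r y"
    using awalk_decomp[OF p(1) ab(2)] by blast
  \<comment> \<open>Both pieces of a shortest walk are shortest: neither is shorter than the
    distance of its ends, and their total is at most the sum of these distances.\<close>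
  have len: "length q = gdist G x b" "length r = gdist G b y"
    using gdist_le[OF qr(2)] gdist_le[OF qr(3)] gdist_triangle[of x b y] V p(2) qr(1) by auto
  consider "a \<in> set (pawalk_verts x q)" | "a \<in> set (pawalk_verts b r)"
    using ab(1) qr by (auto simp: set_awalk_verts_append)
  then show ?thesis
  proof cases
    case 1
    then obtain q1 q2 where q: "q = q1 @ q2" "awalk x q1 a" "awalk a q2 b"
      using awalk_decomp[OF qr(2)] by blast
    then show ?thesis
      using gdist_le[OF q(2)] gdist_le[OF q(3)] gdist_triangle[of x a b] V len by auto
  next
    case 2
    then obtain r1 r2 where r: "r = r1 @ r2" "awalk b r1 a" "awalk a r2 y"
      using awalk_decomp[OF qr(3)] by blast
    \<comment> \<open>Here \<open>b\<close> comes before \<open>a\<close> on the walk, so the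
      assumed order of the distances from \<open>x\<close> forces \<open>a = b\<close>.\<close>
    have "gdist G x b + gdist G b a = gdist G x a"
      using gdist_le[OF r(2)] gdist_le[OF r(3)] gdist_triangle[of x a y] gdist_triangle[of x b a]
        V len p(2) qr(1) r(1) by auto
    then have "gdist G b a = 0" using le by simp
    then have "a = b" using V by (simp add: gdist_eq_0_iff)
    then show ?thesis using V by simp
  qed
qed

text \<open>Replaces paths by distances of triples, the form used in all later arguments. If the
  distances add up, two geodesics concatenate to one through all three vertices; conversely, three
  vertices on a geodesic, sorted by distance from its start, have additive distances.\<close>

lemma general_position_iff:
  "general_position G X \<longleftrightarrow> X \<subseteq> pverts G \<and>
    (\<forall>x\<in>X. \<forall>y\<in>X. \<forall>z\<in>X. x \<noteq> y \<longrightarrow> y \<noteq> z \<longrightarrow> x \<noteq> z \<longrightarrow> gdist G x z \<noteq> gdist G x y + gdist G y z)"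
  (is "_ \<longleftrightarrow> _ \<and> ?R")
proof (intro iffI conjI)
  assume gp: "general_position G X"
  then show sub: "X \<subseteq> pverts G" by (simp add: general_position_def)
  show ?R
  proof (intro ballI impI notI)
    fix x y z
    assume xyz: "x \<in> X" "y \<in> X" "z \<in> X" "x \<noteq> y" "y \<noteq> z" "x \<noteq> z"
      and add: "gdist G x z = gdist G x y + gdist G y z"
    have V: "x \<in> pverts G" "y \<in> pverts G" "z \<in> pverts G" using xyz sub by auto
    obtain p where p: "awalk x p y" "length p = gdist G x y"
      using V by (auto elim: shortest_awalkE)
    obtain q where q: "awalk y q z" "length q = gdist G y z"
      using V by (auto elim: shortest_awalkE)
    have walk: "awalk x (p @ q) z" by (rule awalk_appendI[OF p(1) q(1)])
    \<comment> \<open>A repeated vertex would give a nonempty closed subwalk; cutting it out leaves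
      a walk shorter than the distance.\<close>
    have "distinct (pawalk_verts x (p @ q))"
    proof (rule ccontr)
      assume "\<not> ?thesis"
      then obtain p1 c p2 where d: "p @ q = p1 @ c @ p2" "\<exists>w. awalk x p1 w \<and> awalk w c w \<and> awalk w p2 z" "c \<noteq> []"
        using awalk_not_distinct_decomp[OF walk] by (auto simp: closed_w_def)
      then obtain w where "awalk x p1 w" "awalk w p2 z" by blast
      then have "gdist G x z \<le> length (p1 @ p2)" by (intro gdist_le awalk_appendI)
      also have "\<dots> < length (p @ q)" using d by simp
      finally show False using p q add by simp
    qed
    then have "shortest_path G x (p @ q) z"
      using walk p q add by (simp add: shortest_path_def apath_def)
    then have "card (X \<inter> set (pawalk_verts x (p @ q))) \<le> 2"
      using gp by (auto simp: general_position_def)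
    moreover have "{x, y, z} \<subseteq> X \<inter> set (pawalk_verts x (p @ q))"
      using xyz p q hd_in_awalk_verts(1)[OF p(1)] hd_in_awalk_verts(1)[OF q(1)]
        awlast_of_awalk[OF q(1)] last_in_set[of "pawalk_verts y q"]
      by (auto simp: set_awalk_verts_append[OF p(1) q(1)])
    then have "card {x, y, z} \<le> card (X \<inter> set (pawalk_verts x (p @ q)))"
      by (intro card_mono) auto
    ultimately show False using xyz by simp
  qed
next
  assume R: "X \<subseteq> pverts G \<and> ?R"
  show "general_position G X"
    unfolding general_position_def
  proof (intro conjI allI impI)
    show "X \<subseteq> pverts G" using R by simp
    fix x p y
    assume "shortest_path G x p y"
    then have p: "awalk x p y" "length p = gdist G x y"
      by (auto simp: shortest_path_def apath_def)
    show "card (X \<inter> set (pre_digraph.awalk_verts (with_proj G) x p)) \<le> 2" (is "card ?Y \<le> 2")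
    proof (rule ccontr)
      assume "\<not> ?thesis"
      then have "3 \<le> card ?Y" by simp
      then obtain Z where Z: "Z \<subseteq> ?Y" "card Z = 3" by (rule obtain_subset_with_card_n)
      obtain a b c where "Z = {a, b, c}" and ne: "a \<noteq> b" "b \<noteq> c" "a \<noteq> c"
        using Z(2) by (auto simp: card_3_iff)
      then have abc: "a \<in> ?Y" "b \<in> ?Y" "c \<in> ?Y" using Z(1) by blast+
      \<comment> \<open>The sorted case. Some ordering of the three vertices always satisfies its
        two inequalities.\<close>
      have chain: False
        if "a \<in> ?Y" "b \<in> ?Y" "c \<in> ?Y" "a \<noteq> b" "b \<noteq> c" "a \<noteq> c"
          "gdist G x a \<le> gdist G x b" "gdist G x b \<le> gdist G x c" for a b c
      proof -
        have V: "x \<in> pverts G" "a \<in> pverts G" "b \<in> pverts G" "c \<in> pverts G"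
          using that R p(1) by auto
        have "gdist G x b = gdist G x a + gdist G a b" "gdist G x c = gdist G x b + gdist G b c"
          using that by (auto intro!: shortest_path_mono_dist[OF p])
        then have "gdist G a c = gdist G a b + gdist G b c"
          using gdist_triangle[of x a c] gdist_triangle[of a b c] V by simp
        then show False using R that by blast
      qed
      show False by (metis chain abc ne linear)
    qed
  qed
qed

section \<open>The extremal numbers \<open>gp\<close> and \<open>\<xi>_at\<close>\<close>

lemma general_position_subset:
  assumes "general_position G X" "Y \<subseteq> X"
  shows "general_position G Y"
  using assms unfolding general_position_iff by (meson subset_iff)

lemma finite_general_position:
  assumes "general_position G X"
  shows "finite X"
  using assms finite_subset[OF _ pair_finite_verts] by (simp add: general_position_def)

text \<open>Serves both \<open>gp\<close> and \<open>\<xi>_at\<close>: \<open>Max\<close> is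
  meaningful only on a finite set.\<close>

lemma finite_cards:
  assumes "\<And>S. P S \<Longrightarrow> general_position G S"
  shows "finite {card S |S. P S}"
proof -
  have "{card S |S. P S} \<subseteq> card ` Pow (pverts G)"
    using assms by (auto simp: general_position_def)
  then show ?thesis by (rule finite_subset) (simp add: pair_finite_verts)
qed

lemma card_le_gp:
  assumes "general_position G X"
  shows "card X \<le> gp G"
  unfolding gp_def using assms by (intro Max_ge finite_cards) auto

lemma gp_attained:
  obtains X where "general_position G X" "card X = gp G"
proof -
  have "general_position G {}" by (simp add: general_position_iff)
  then have "gp G \<in> {card X |X. general_position G X}"
    unfolding gp_def by (intro Max_in finite_cards) auto
  then show thesis using that by auto
qed

lemma card_le_\<xi>_at:
  assumes "colinear G u S"
  shows "card S \<le> \<xi>_at G u"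
  unfolding \<xi>_at_def using assms by (intro Max_ge finite_cards) (auto simp: colinear_def)

lemma \<xi>_at_attained:
  obtains S where "colinear G u S" "card S = \<xi>_at G u"
proof -
  have "colinear G u {}" by (simp add: colinear_def general_position_iff)
  then have "\<xi>_at G u \<in> {card S |S. colinear G u S}"
    unfolding \<xi>_at_def by (intro Max_in finite_cards) (auto simp: colinear_def)
  then show thesis using that by auto
qed

text \<open>Any single vertex other than \<open>u\<close> is colinear. This unit later pays for
  \<open>u\<close> itself, when a general position set contains it, and for a slice that is only a
  bridge end.\<close>

lemma \<xi>_at_pos:
  assumes "card (pverts G) \<ge> 2"
  shows "\<xi>_at G u \<ge> 1"
proof -
  have "\<not> pverts G \<subseteq> {u}" using assms card_mono[of "{u}" "pverts G"] by auto
  then obtain v where "v \<in> pverts G" "v \<noteq> u" by blast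
  then have "colinear G u {v}" by (simp add: colinear_def general_position_iff)
  then show ?thesis using card_le_\<xi>_at by fastforce
qed

text \<open>
  The relation \<open>y \<in> ginterval G x u\<close> is an order on the vertices; a chain of three elements
  would lie on a geodesic, so a general position set splits into two antichains.
\<close>
lemma general_position_card_le:
  assumes gp: "general_position G X" and u: "u \<in> pverts G" and card: "card (pverts G) \<ge> 2"
  shows "card X \<le> 2 * \<xi>_at G u"
proof -
  have V: "X \<subseteq> pverts G" using gp by (simp add: general_position_iff)
  have fin: "finite X" by (rule finite_general_position[OF gp])
  have no3: False
    if "x \<in> X" "y \<in> X" "z \<in> X" "x \<noteq> y" "y \<noteq> z" "y \<in> ginterval G x u" "z \<in> ginterval G y u"
    for x y z
  proof -
    have W: "x \<in> pverts G" "y \<in> pverts G" "z \<in> pverts G" using that V by auto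
    have *: "gdist G x u = gdist G x y + gdist G y u" "gdist G y u = gdist G y z + gdist G z u"
      using that by (auto simp: ginterval_def)
    then have "gdist G x z = gdist G x y + gdist G y z"
      using gdist_triangle[of x y z] gdist_triangle[of x z u] W u by simp
    \<comment> \<open>The distance to \<open>u\<close> drops strictly from \<open>x\<close> to
      \<open>y\<close> and does not rise from \<open>y\<close> to \<open>z\<close>, so
      \<open>x\<close> and \<open>z\<close> differ.\<close>
    moreover have "gdist G x y \<noteq> 0" using W that by (simp add: gdist_eq_0_iff)
    then have "x \<noteq> z" using * by auto
    ultimately show False using gp that unfolding general_position_iff by blast
  qed
  show ?thesis
  proof (cases "u \<in> X")
    case True
    \<comment> \<open>Every vertex lies above \<open>u\<close> in the order, so a comparable pair in
      \<open>X - {u}\<close> would extend by \<open>u\<close> to a chain of three in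
      \<open>X\<close>.\<close>
    have "u \<in> ginterval G y u" if "y \<in> pverts G" for y
      using that u by (simp add: ginterval_def)
    then have "colinear G u (X - {u})"
      unfolding colinear_def using general_position_subset[OF gp, of "X - {u}"] no3[OF _ _ True] V
      by (metis DiffD1 DiffD2 Diff_subset insertI1 subsetD)
    then have "card (X - {u}) \<le> \<xi>_at G u" by (rule card_le_\<xi>_at)
    then show ?thesis using \<xi>_at_pos[OF card, of u] fin True by simp
  next
    case False
    \<comment> \<open>\<open>A\<close> consists of the elements of \<open>X\<close> that are not
      minimal in the order towards \<open>u\<close>. A comparable pair inside \<open>A\<close> would
      continue to a chain of three; the minimal elements are pairwise incomparable.\<close>
    define A where "A = {x \<in> X. \<exists>y\<in>X. y \<noteq> x \<and> y \<in> ginterval G x u}"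
    have "colinear G u A"
      unfolding colinear_def using general_position_subset[OF gp, of A] no3 False
      by (auto simp: A_def)
    moreover have "colinear G u (X - A)"
      unfolding colinear_def using general_position_subset[OF gp, of "X - A"] False
      by (auto simp: A_def)
    moreover have "card X = card A + card (X - A)"
      using fin card_Diff_subset[of A X] card_mono[of X A] finite_subset[of A X] by (auto simp: A_def)
    ultimately show ?thesis using card_le_\<xi>_at[of u A] card_le_\<xi>_at[of u "X - A"] by simp
  qed
qed

end


lemma (in pair_graph) connected_pair_graphI:
  assumes "Digraph_Component.connected (with_proj G)"
  shows "connected_pair_graph G"
proof
  fix x y
  assume "x \<in> pverts G" "y \<in> pverts G"
  then have "x \<rightarrow>\<^sup>*\<^bsub>with_proj G\<^esub> y"
    using symmetric_connected_imp_strongly_connected[OF pair_sym_arcs assms]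
    by (auto simp: strongly_connected_def)
  then show "\<exists>p. awalk x p y" by (simp add: reachable_awalk)
qed

section \<open>The product as two copies of \<open>H\<close> joined by a bridge\<close>

locale sierpinski_product_K2 = H: connected_pair_graph H
  for H :: "'b pair_pre_digraph" +
  fixes K :: "'a pair_pre_digraph" and f :: "'a \<Rightarrow> 'b" and a b :: 'a
  assumes K: "pair_graph K" "a \<noteq> b" "pverts K = {a, b}" "parcs K = {(a, b), (b, a)}"
    and f: "f a \<in> pverts H" "f b \<in> pverts H"
begin

abbreviation P :: "('a \<times> 'b) pair_pre_digraph" where
  "P \<equiv> sierpinski_product K f H"

text \<open>The bridge end in copy \<open>g\<close>, so that one argument serves both copies.
  Outside \<open>{a, b}\<close> the value is a default that is still a vertex of
  \<open>H\<close>.\<close>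

definition link :: "'a \<Rightarrow> 'b" where
  "link g = (if g = a then f b else f a)"

lemma link_in_verts [simp]: "link g \<in> pverts H"
  using f by (simp add: link_def)

lemma verts_P: "pverts P = {a, b} \<times> pverts H"
  by (simp add: sierpinski_product_def K)

lemma arc_K_iff: "(g, g') \<in> parcs K \<longleftrightarrow> g \<in> {a, b} \<and> g' \<in> {a, b} \<and> g \<noteq> g'"
  using K(2) by (auto simp: K(4))

lemma arcs_P:
  "parcs P = {((g, h), (g, h')) | g h h'. g \<in> {a, b} \<and> (h, h') \<in> parcs H} \<union>
    {((g, link g), (g', link g')) | g g'. (g, g') \<in> parcs K}"
proof -
  have "link g = f g'" "link g' = f g" if "(g, g') \<in> parcs K" for g g'
    using that K(2) by (auto simp: K(4) link_def)
  then have "{((g, f g'), (g', f g)) | g g'. (g, g') \<in> parcs K} =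
      {((g, link g), (g', link g')) | g g'. (g, g') \<in> parcs K}"
    by (intro Collect_cong) metis
  then show ?thesis by (simp add: sierpinski_product_def K(3))
qed

lemma pair_graph_P: "pair_graph P"
  using f by (intro pair_graph_sierpinski_product K(1) H.pair_graph) (auto simp: K)

sublocale P: pair_graph P
  by (rule pair_graph_P)

section \<open>Distances in the product\<close>

lemma awalk_copy:
  assumes "H.awalk x p y" "g \<in> {a, b}"
  shows "P.awalk (g, x) (map (\<lambda>(u, v). ((g, u), (g, v))) p) (g, y)"
  using assms(1)
proof (induct p arbitrary: x)
  case Nil
  then show ?case using assms(2) by (auto simp: H.awalk_Nil_iff P.awalk_Nil_iff verts_P)
next
  case (Cons e p)
  then show ?case
    using assms(2) by (cases e) (auto simp: H.awalk_Cons_iff P.awalk_Cons_iff arcs_P)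
qed

lemma awalk_same_copy:
  assumes "g \<in> {a, b}" "x \<in> pverts H" "y \<in> pverts H"
  shows "\<exists>p. P.awalk (g, x) p (g, y) \<and> length p = gdist H x y"
proof -
  obtain p where "H.awalk x p y" "length p = gdist H x y"
    using assms(2,3) by (rule H.shortest_awalkE)
  then show ?thesis using awalk_copy[OF _ assms(1)] by (metis length_map)
qed

lemma awalk_other_copy:
  assumes "g \<in> {a, b}" "g' \<in> {a, b}" "g \<noteq> g'" "x \<in> pverts H" "y \<in> pverts H"
  shows "\<exists>p. P.awalk (g, x) p (g', y) \<and> length p = gdist H x (link g) + 1 + gdist H (link g') y"
proof -
  obtain p where p: "P.awalk (g, x) p (g, link g)" "length p = gdist H x (link g)"
    using awalk_same_copy[of g x "link g"] assms by auto
  obtain q where q: "P.awalk (g', link g') q (g', y)" "length q = gdist H (link g') y"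
    using awalk_same_copy[of g' "link g'" y] assms by auto
  have "((g, link g), (g', link g')) \<in> parcs P" using assms(1-3) by (auto simp: arcs_P arc_K_iff)
  then have "P.awalk (g, link g) (((g, link g), (g', link g')) # q) (g', y)"
    using q by (simp add: P.awalk_Cons_iff)
  from P.awalk_appendI[OF p(1) this] p(2) q(2) show ?thesis
    by (intro exI[of _ "p @ ((g, link g), (g', link g')) # q"]) simp
qed

sublocale P: connected_pair_graph P
proof
  fix x y
  assume "x \<in> pverts P" "y \<in> pverts P"
  then show "\<exists>p. P.awalk x p y"
    using awalk_same_copy[of "fst x" "snd x" "snd y"]
      awalk_other_copy[of "fst x" "fst y" "snd x" "snd y"]
    by (cases "fst x = fst y") (auto simp: verts_P)
qed

text \<open>The expected distance to \<open>(g', y)\<close> is itself taken as the potential; it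
  remains to check the two kinds of arcs.\<close>

lemma potential_le_gdist_P:
  assumes "g \<in> {a, b}" "g' \<in> {a, b}" "x \<in> pverts H" "y \<in> pverts H"
  shows "(if g = g' then gdist H x y else gdist H x (link g) + 1 + gdist H (link g') y)
    \<le> gdist P (g, x) (g', y)"
proof -
  define \<phi> where "\<phi> v = (if fst v = g' then gdist H (snd v) y
    else gdist H (snd v) (link (fst v)) + 1 + gdist H (link g') y)" for v
  have "\<phi> (g, x) \<le> gdist P (g, x) (g', y)"
  proof (rule P.potential_le_gdist)
    show "(g, x) \<in> pverts P" "(g', y) \<in> pverts P" using assms by (auto simp: verts_P)
    show "\<phi> (g', y) = 0" using assms by (simp add: \<phi>_def)
    show "\<phi> u \<le> Suc (\<phi> v)" if "(u, v) \<in> parcs P" for u v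
    proof -
      consider (copy) c h h' where "u = (c, h)" "v = (c, h')" "(h, h') \<in> parcs H"
        | (cross) c c' where "u = (c, link c)" "v = (c', link c')" "(c, c') \<in> parcs K"
        using \<open>(u, v) \<in> parcs P\<close> unfolding arcs_P by blast
      then show ?thesis
      proof cases
        case copy
        then show ?thesis
          using H.gdist_arc_Suc[OF copy(3), of y] H.gdist_arc_Suc[OF copy(3), of "link c"] assms(4)
          by (simp add: \<phi>_def)
      next
        case cross
        \<comment> \<open>With only two copies, the bridge has exactly one end in the target copy.
          Crossing towards it lowers the potential by exactly one.\<close>
        then have "c = g' \<or> c' = g'" "c \<noteq> c'" using assms(2) by (auto simp: arc_K_iff)
        then show ?thesis using cross(1,2) by (auto simp: \<phi>_def)
      qed
    qed
  qed
  then show ?thesis by (simp only: \<phi>_def fst_conv snd_conv)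
qed

lemma gdist_same_copy:
  assumes "g \<in> {a, b}" "x \<in> pverts H" "y \<in> pverts H"
  shows "gdist P (g, x) (g, y) = gdist H x y"
proof (rule le_antisym)
  show "gdist P (g, x) (g, y) \<le> gdist H x y"
    using awalk_same_copy[OF assms] P.gdist_le by fastforce
  show "gdist H x y \<le> gdist P (g, x) (g, y)"
    using potential_le_gdist_P[OF assms(1,1,2,3)] by simp
qed

lemma gdist_other_copy:
  assumes "g \<in> {a, b}" "g' \<in> {a, b}" "g \<noteq> g'" "x \<in> pverts H" "y \<in> pverts H"
  shows "gdist P (g, x) (g', y) = gdist H x (link g) + 1 + gdist H (link g') y"
proof (rule le_antisym)
  show "gdist P (g, x) (g', y) \<le> gdist H x (link g) + 1 + gdist H (link g') y"
    using awalk_other_copy[OF assms] P.gdist_le by fastforce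
  show "gdist H x (link g) + 1 + gdist H (link g') y \<le> gdist P (g, x) (g', y)"
    using potential_le_gdist_P[OF assms(1,2,4,5)] assms(3) by simp
qed

section \<open>Upper bound for \<open>gp\<close> of the product\<close>

lemma general_position_slice:
  assumes gp: "general_position P X" and g: "g \<in> {a, b}"
  shows "general_position H {h. (g, h) \<in> X}"
proof -
  have sub: "X \<subseteq> {a, b} \<times> pverts H" using gp by (simp add: P.general_position_iff verts_P)
  show ?thesis
    unfolding H.general_position_iff
  proof (intro conjI ballI impI)
    show "{h. (g, h) \<in> X} \<subseteq> pverts H" using sub by auto
    fix x y z
    assume "x \<in> {h. (g, h) \<in> X}" "y \<in> {h. (g, h) \<in> X}" "z \<in> {h. (g, h) \<in> X}"
      and "x \<noteq> y" "y \<noteq> z" "x \<noteq> z"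
    moreover from this have "x \<in> pverts H" "y \<in> pverts H" "z \<in> pverts H" using sub by auto
    ultimately show "gdist H x z \<noteq> gdist H x y + gdist H y z"
      using gp g unfolding P.general_position_iff
      by (metis gdist_same_copy mem_Collect_eq prod.inject)
  qed
qed

text \<open>A geodesic from copy \<open>g\<close> to \<open>(g', z)\<close> leaves through
  \<open>link g\<close>. A vertex of the slice between another one and \<open>link g\<close> would
  therefore lie between that one and \<open>(g', z)\<close>.\<close>

lemma card_slice_le:
  assumes gp: "general_position P X" and g: "g \<in> {a, b}" "g' \<in> {a, b}" "g \<noteq> g'"
    and z: "(g', z) \<in> X" and card: "card (pverts H) \<ge> 2"
  shows "card {h. (g, h) \<in> X} \<le> \<xi>_at H (link g)"
proof -
  let ?S = "{h. (g, h) \<in> X}"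
  have sub: "X \<subseteq> {a, b} \<times> pverts H" using gp by (simp add: P.general_position_iff verts_P)
  have between: "y \<notin> ginterval H x (link g)" if "x \<in> ?S" "y \<in> ?S" "x \<noteq> y" for x y
  proof
    assume "y \<in> ginterval H x (link g)"
    moreover have V: "x \<in> pverts H" "y \<in> pverts H" "z \<in> pverts H" using that sub z by auto
    ultimately have "gdist P (g, x) (g', z) = gdist P (g, x) (g, y) + gdist P (g, y) (g', z)"
      using g by (simp add: gdist_other_copy gdist_same_copy ginterval_def)
    then show False using gp that g z unfolding P.general_position_iff by blast
  qed
  show ?thesis
  proof (cases "link g \<in> ?S")
    case True
    \<comment> \<open>\<open>link g\<close> lies between every vertex and itself, so a slice
      containing it has no other element.\<close>
    have "x = link g" if "x \<in> ?S" for x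
      using between[OF that True] that sub by (auto simp: ginterval_def)
    then have "?S \<subseteq> {link g}" by auto
    then have "card ?S \<le> 1" using card_mono[of "{link g}" ?S] by simp
    then show ?thesis using H.\<xi>_at_pos[OF card, of "link g"] by simp
  next
    case False
    then have "colinear H (link g) ?S"
      using between general_position_slice[OF gp g(1)] by (auto simp: colinear_def)
    then show ?thesis by (rule H.card_le_\<xi>_at)
  qed
qed

lemma card_eq_slices:
  assumes "general_position P X"
  shows "card X = card {h. (a, h) \<in> X} + card {h. (b, h) \<in> X}"
proof -
  have sub: "X \<subseteq> {a, b} \<times> pverts H" using assms by (simp add: P.general_position_iff verts_P)
  have "X = Pair a ` {h. (a, h) \<in> X} \<union> Pair b ` {h. (b, h) \<in> X}" using sub by auto
  moreover have "finite {h. (g, h) \<in> X}" if "g \<in> {a, b}" for g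
    using general_position_slice[OF assms that] by (rule H.finite_general_position)
  then have "card (Pair a ` {h. (a, h) \<in> X} \<union> Pair b ` {h. (b, h) \<in> X}) =
      card {h. (a, h) \<in> X} + card {h. (b, h) \<in> X}"
    using K(2) by (subst card_Un_disjoint) (auto simp: card_image inj_on_def)
  ultimately show ?thesis by simp
qed

lemma card_general_position_P_le:
  assumes gp: "general_position P X" and card: "card (pverts H) \<ge> 2"
  shows "card X \<le> \<xi>_at H (f a) + \<xi>_at H (f b)"
proof -
  let ?A = "{h. (a, h) \<in> X}" and ?B = "{h. (b, h) \<in> X}"
  have links: "link a = f b" "link b = f a" using K(2) by (simp_all add: link_def)
  \<comment> \<open>A set inside one copy is bounded by twice either summand, hence by their
    average, which is half the sum of both bounds.\<close>
  have one: "card S \<le> \<xi>_at H (f a) + \<xi>_at H (f b)" if "general_position H S" for S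
    using H.general_position_card_le[OF that f(1) card] H.general_position_card_le[OF that f(2) card]
    by simp
  consider "?A = {}" | "?B = {}" | x y where "(a, x) \<in> X" "(b, y) \<in> X" by auto
  then show ?thesis
  proof cases
    case 1
    have "card X = card ?B" using card_eq_slices[OF gp] 1 by simp
    also have "\<dots> \<le> \<xi>_at H (f a) + \<xi>_at H (f b)" by (rule one[OF general_position_slice[OF gp]]) simp
    finally show ?thesis .
  next
    case 2
    have "card X = card ?A" using card_eq_slices[OF gp] 2 by simp
    also have "\<dots> \<le> \<xi>_at H (f a) + \<xi>_at H (f b)" by (rule one[OF general_position_slice[OF gp]]) simp
    finally show ?thesis .
  next
    case 3
    have "card ?A \<le> \<xi>_at H (f b)" using card_slice_le[OF gp _ _ _ 3(2) card, of a] K(2) links by simp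
    moreover have "card ?B \<le> \<xi>_at H (f a)"
      using card_slice_le[OF gp _ _ _ 3(1) card, of b] K(2) links by simp
    ultimately show ?thesis using card_eq_slices[OF gp] by simp
  qed
qed

section \<open>Lower bound for \<open>gp\<close> of the product\<close>

text \<open>Of three vertices, two share a copy. If all three do, general position in
  \<open>H\<close> decides; if an outer one is alone, colinearity does; if the middle one is alone,
  the detour crosses the bridge twice.\<close>

lemma general_position_union:
  assumes S: "\<And>g. g \<in> {a, b} \<Longrightarrow> colinear H (link g) (S g)"
  shows "general_position P (Sigma {a, b} S)"
proof -
  have sub: "S g \<subseteq> pverts H" if "g \<in> {a, b}" for g
    using S[OF that] by (simp add: colinear_def H.general_position_iff)
  \<comment> \<open>Colinearity as a strict triangle inequality.\<close>
  have pair: "gdist H x (link g) < gdist H x y + gdist H y (link g)"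
    if "g \<in> {a, b}" "x \<in> S g" "y \<in> S g" "x \<noteq> y" for g x y
  proof -
    have "x \<in> pverts H" "y \<in> pverts H" using that sub by auto
    moreover have "y \<notin> ginterval H x (link g)" using S[OF that(1)] that by (simp add: colinear_def)
    ultimately show ?thesis using H.gdist_triangle[of x y "link g"] by (simp add: ginterval_def)
  qed
  have triple: "gdist H x z \<noteq> gdist H x y + gdist H y z"
    if "g \<in> {a, b}" "x \<in> S g" "y \<in> S g" "z \<in> S g" "x \<noteq> y" "y \<noteq> z" "x \<noteq> z" for g x y z
    using S[OF that(1)] that unfolding colinear_def H.general_position_iff by blast
  have comm: "gdist H x y = gdist H y x" if "g \<in> {a, b}" "x \<in> S g" "y \<in> S g \<union> {link g}" for g x y
    using that sub by (intro H.gdist_commute) auto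
  show ?thesis
    unfolding P.general_position_iff
  proof (intro conjI ballI impI)
    show "Sigma {a, b} S \<subseteq> pverts P" using sub by (auto simp: verts_P)
    fix u v w
    assume mem: "u \<in> Sigma {a, b} S" "v \<in> Sigma {a, b} S" "w \<in> Sigma {a, b} S"
      and ne: "u \<noteq> v" "v \<noteq> w" "u \<noteq> w"
    obtain g x where u: "u = (g, x)" "g \<in> {a, b}" "x \<in> S g" using mem(1) by auto
    obtain g' y where v: "v = (g', y)" "g' \<in> {a, b}" "y \<in> S g'" using mem(2) by auto
    obtain g'' z where w: "w = (g'', z)" "g'' \<in> {a, b}" "z \<in> S g''" using mem(3) by auto
    have V: "x \<in> pverts H" "y \<in> pverts H" "z \<in> pverts H" using u v w sub by auto
    consider (same) "g = g'" "g' = g''" | (l) "g = g'" "g' \<noteq> g''" | (r) "g \<noteq> g'" "g' = g''"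
      | (m) "g = g''" "g \<noteq> g'"
      using u v w by auto
    then show "gdist P u w \<noteq> gdist P u v + gdist P v w"
    proof cases
      case same
      then show ?thesis using u v w ne V triple[of g x y z] by (simp add: gdist_same_copy)
    next
      case l
      then show ?thesis
        using u v w ne V pair[of g x y] by (simp add: gdist_same_copy gdist_other_copy)
    next
      \<comment> \<open>Mirror image of the previous case; the distances are reversed because
        \<open>pair\<close> measures towards the bridge end.\<close>
      case r
      then show ?thesis
        using u v w ne V pair[of g'' z y] comm[of g'' z y] comm[of g'' z "link g''"]
          comm[of g'' y "link g''"]
        by (simp add: gdist_same_copy gdist_other_copy)
    next
      case m
      then show ?thesis
        using u v w V H.gdist_triangle[of x "link g" z]
        by (simp add: gdist_same_copy gdist_other_copy)
    qed
  qed
qed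

lemma gp_P:
  assumes card: "card (pverts H) \<ge> 2"
  shows "gp P = \<xi>_at H (f a) + \<xi>_at H (f b)"
proof (rule le_antisym)
  show "gp P \<le> \<xi>_at H (f a) + \<xi>_at H (f b)"
    by (rule P.gp_attained) (use card_general_position_P_le[OF _ card] in fastforce)
  obtain A where A: "colinear H (f b) A" "card A = \<xi>_at H (f b)" by (rule H.\<xi>_at_attained)
  obtain B where B: "colinear H (f a) B" "card B = \<xi>_at H (f a)" by (rule H.\<xi>_at_attained)
  \<comment> \<open>The copy of \<open>a\<close> receives the set for \<open>f b\<close>, because
    its bridge end is \<open>f b\<close>.\<close>
  define S where "S g = (if g = a then A else B)" for g
  have gp: "general_position P (Sigma {a, b} S)"
    using A B K(2) by (intro general_position_union) (auto simp: S_def link_def)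
  then have "card (Sigma {a, b} S) = card A + card B"
    using K(2) card_eq_slices[OF gp] by (simp add: S_def)
  then show "\<xi>_at H (f a) + \<xi>_at H (f b) \<le> gp P"
    using P.card_le_gp[OF gp] A B by simp
qed

end

section \<open>Optimizing over all functions \<open>f\<close>\<close>

lemma Min_Max_pairwise_sums:
  fixes h :: "'a \<Rightarrow> nat"
  assumes "finite V" "V \<noteq> {}"
  shows "Min ((\<lambda>(x, y). h x + h y) ` (V \<times> V)) = 2 * Min (h ` V)"
    and "Max ((\<lambda>(x, y). h x + h y) ` (V \<times> V)) = 2 * Max (h ` V)"
proof -
  let ?D = "(\<lambda>(x, y). h x + h y) ` (V \<times> V)"
  have fin: "finite ?D" using assms by simp
  have "Min (h ` V) \<in> h ` V" by (rule Min_in) (use assms in simp_all)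
  then obtain x where x: "x \<in> V" "h x = Min (h ` V)" by (metis imageE)
  have "Max (h ` V) \<in> h ` V" by (rule Max_in) (use assms in simp_all)
  then obtain y where y: "y \<in> V" "h y = Max (h ` V)" by (metis imageE)
  have bounds: "h x \<le> h z" "h z \<le> h y" if "z \<in> V" for z
    using assms that unfolding x(2) y(2) by auto
  \<comment> \<open>Each summand is at least \<open>h x\<close>, and the diagonal pair
    \<open>(x, x)\<close> attains the bound; the maximum is dual.\<close>
  have "Min ?D = 2 * h x"
  proof (rule Min_eqI[OF fin])
    show "2 * h x \<le> d" if d: "d \<in> ?D" for d
    proof -
      obtain u v where "u \<in> V" "v \<in> V" "d = h u + h v" using d by auto
      then show ?thesis using bounds(1)[of u] bounds(1)[of v] by simp
    qed
    show "2 * h x \<in> ?D" using x(1) by (intro image_eqI[of _ _ "(x, x)"]) auto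
  qed
  then show "Min ?D = 2 * Min (h ` V)" using x(2) by simp
  have "Max ?D = 2 * h y"
  proof (rule Max_eqI[OF fin])
    show "d \<le> 2 * h y" if d: "d \<in> ?D" for d
    proof -
      obtain u v where "u \<in> V" "v \<in> V" "d = h u + h v" using d by auto
      then show ?thesis using bounds(2)[of u] bounds(2)[of v] by simp
    qed
    show "2 * h y \<in> ?D" using y(1) by (intro image_eqI[of _ _ "(y, y)"]) auto
  qed
  then show "Max ?D = 2 * Max (h ` V)" using y(2) by simp
qed

theorem theorem4p4:
  fixes K2 :: "'a pair_pre_digraph" and H :: "'b pair_pre_digraph"
  assumes K2: "complete_digraph 2 (with_proj K2)"
    and H: "pair_graph H"
    and H_connected: "Digraph_Component.connected (with_proj H)"
    and H_card: "card (pverts H) \<ge> 2"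
  shows "gp_S_min K2 H = 2 * \<xi>_min H \<and> gp_S_max K2 H = 2 * \<xi>_max H"
proof -
  interpret H: connected_pair_graph H
    using pair_graph.connected_pair_graphI[OF H H_connected] .
  obtain a b where ab: "a \<noteq> b" "pverts K2 = {a, b}"
    using K2 by (metis complete_digraph_pair_def card_2_iff)
  have arcs: "parcs K2 = {(a, b), (b, a)}"
    using K2 ab by (auto simp: complete_digraph_pair_def)
  have gp: "gp (sierpinski_product K2 f H) = \<xi>_at H (f a) + \<xi>_at H (f b)"
    if "f a \<in> pverts H" "f b \<in> pverts H" for f
  proof -
    interpret sierpinski_product_K2 H K2 f a b
      using that ab arcs pair_graphI_complete[OF K2]
      by (intro sierpinski_product_K2.intro sierpinski_product_K2_axioms.intro
          H.connected_pair_graph_axioms)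
    show ?thesis by (rule gp_P[OF H_card])
  qed
  \<comment> \<open>A function on two vertices is a free choice of two values, so the values of
    \<open>gp\<close> are exactly the pairwise sums.\<close>
  have "{gp (sierpinski_product K2 f H) | f. f \<in> pverts K2 \<rightarrow>\<^sub>E pverts H} =
      (\<lambda>(x, y). \<xi>_at H x + \<xi>_at H y) ` (pverts H \<times> pverts H)" (is "?L = ?R")
  proof (intro equalityI subsetI)
    fix n assume "n \<in> ?L"
    then obtain f where "f \<in> pverts K2 \<rightarrow>\<^sub>E pverts H" "n = gp (sierpinski_product K2 f H)" by blast
    moreover from this have "f a \<in> pverts H" "f b \<in> pverts H" using ab by auto
    ultimately show "n \<in> ?R" using gp by auto
  next
    fix n assume "n \<in> ?R"
    then obtain x y where xy: "x \<in> pverts H" "y \<in> pverts H" "n = \<xi>_at H x + \<xi>_at H y" by auto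
    \<comment> \<open>The restriction to \<open>pverts K2\<close> makes \<open>f\<close>
      extensional, as the function space requires.\<close>
    define f where "f = (\<lambda>g\<in>pverts K2. if g = a then x else y)"
    have f: "f \<in> pverts K2 \<rightarrow>\<^sub>E pverts H" "f a = x" "f b = y" using xy ab by (auto simp: f_def)
    then have "n = gp (sierpinski_product K2 f H)" using gp[of f] xy by simp
    then show "n \<in> ?L" using f(1) by blast
  qed
  moreover have "pverts H \<noteq> {}" using H_card by auto
  ultimately show ?thesis
    unfolding gp_S_min_def gp_S_max_def \<xi>_min_def \<xi>_max_def
    by (simp add: Min_Max_pairwise_sums[OF H.pair_finite_verts])
qed

end
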